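(* (Relations for $\hat E_{n,m}$.) Let $\mathcal L$ be a positive definite linear functional on $\prod^{N,M}$. For $0<n\le N$, $0<m\le M$, $$\Gamma_{n-1,m}\hat E_{n,m}=A_{n,m-1}\mathcal K_{n,m}(I^1_{n-1,m})^\dagger+\hat E_{n,m-1}\overline{\Gamma^1_{n-1,m}},$$ $$\hat E_{n,m}(\Gamma^1_{n-1,m})^T=I_{n-1,m}(\mathcal K^1_{n,m})^TA_{n,m-1}^T+\Gamma_{n-1,m}^\dagger\hat E_{n,m-1}.$$
   Context: $\prod^{N,M}=\mathrm{span}\{z^iw^j:|i|\le N,|j|\le M\}$, $\hat\prod^{N,M}=\mathrm{span}\{z^iw^j:0\le i\le N,0\le j\le M\}$. For a (matrix valued) Laurent polynomial $Q$, $Q^\dagger(z,w)=Q(1/\bar z,1/\bar w)^\dagger$. A linear functional $\mathcal L$ on $\prod^{N,M}$ with $\mathcal L(z^{-i}w^{-j})=\overline{\mathcal L(z^iw^j)}$ is positive definite if $\mathcal L(pp^\dagger)>0$ for all nonzero $p\in\hat\prod^{N,M}$. It is applied entrywise and, for column vectors, $\langle X,Y\rangle=\mathcal L(XY^\dagger)$. Bars on matrices are entrywise conjugates. For $0\le l\le m$, $\phi^l_{n,m}$ is the unique element of $\mathrm{span}(\{z^iw^j:0\le i<n,0\le j\le m\}\cup\{z^nw^j:0\le j\le l\})$ with positive coefficient of $z^nw^l$, $\langle\phi^l_{n,m},\phi^l_{n,m}\rangle=1$, orthogonal to all of these monomials except $z^nw^l$; $\Phi_{n,m}=[\phi^m_{n,m},\dots,\phi^0_{n,m}]^T$.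 For $0\le l\le n$, $\tilde\phi^l_{n,m}$ is the unique element of $\mathrm{span}(\{z^iw^j:0\le i\le n,0\le j<m\}\cup\{z^iw^m:0\le i\le l\})$ with positive coefficient of $z^lw^m$, norm one, orthogonal to all of these monomials except $z^lw^m$; $\tilde\Phi_{n,m}=[\tilde\phi^n_{n,m},\dots,\tilde\phi^0_{n,m}]^T$. Reversals are the row vectors $\overleftarrow\Phi_{n,m}(z,w)=z^nw^m\Phi_{n,m}(1/\bar z,1/\bar w)^\dagger$, $\overleftarrow{\tilde\Phi}_{n,m}(z,w)=z^nw^m\tilde\Phi_{n,m}(1/\bar z,1/\bar w)^\dagger$. Coefficients: $\hat E_{n,m}=\langle z\Phi_{n-1,m},\overleftarrow\Phi_{n-1,m}^T\rangle$, $A_{n,m}=\langle z\Phi_{n-1,m},\Phi_{n,m}\rangle$ ($n\ge1$), $\mathcal K_{n,m}=\langle\Phi_{n,m-1},\tilde\Phi_{n-1,m}\rangle$, $\mathcal K^1_{n,m}=\langle w\Phi_{n,m-1},\overleftarrow{\tilde\Phi}_{n-1,m}^T\rangle$, $\Gamma_{n,m}=\langle\Phi_{n,m-1},\Phi_{n,m}\rangle$, $\Gamma^1_{n,m}=\langle w\Phi_{n,m-1},\Phi_{n,m}\rangle$, $I_{n,m}=\langle\Phi_{n,m},\tilde\Phi_{n,m}\rangle$, $I^1_{n,m}=\langle\overleftarrow\Phi_{n,m}^T,\tilde\Phi_{n,m}\rangle$. *)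

theory Defs
  imports
    "HOL-Library.Poly_Mapping"
    "HOL-Library.Product_Plus"
    "HOL-Library.Complex_Order"
    "Jordan_Normal_Form.Schur_Decomposition"
begin

text \<open>
  Laurent polynomials in z, w are finitely supported coefficient families indexed by exponent
  pairs; the ring structure of \<^theory>\<open>HOL-Library.Poly_Mapping\<close> (convolution over
  the additive group of exponent pairs) is the multiplication of Laurent polynomials.
\<close>

type_synonym laurent = "(int \<times> int) \<Rightarrow>\<^sub>0 complex"

abbreviation lcoeff :: "laurent \<Rightarrow> int \<times> int \<Rightarrow> complex" where
  "lcoeff \<equiv> Poly_Mapping.lookup"

definition lmonom :: "int \<times> int \<Rightarrow> laurent" where
  "lmonom k = Poly_Mapping.single k 1"

definition lscale :: "complex \<Rightarrow> laurent \<Rightarrow> laurent" where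
  "lscale c p = Poly_Mapping.single 0 c * p"

global_interpretation laurent: vector_space lscale
  by unfold_locales
    (simp_all add: lscale_def algebra_simps single_add mult_single flip: mult.assoc)

definition lspan :: "(int \<times> int) set \<Rightarrow> laurent set" where
  "lspan S = laurent.span (lmonom ` S)"

definition Pi_space :: "nat \<Rightarrow> nat \<Rightarrow> laurent set" where
  "Pi_space N M = lspan {(i, j). \<bar>i\<bar> \<le> int N \<and> \<bar>j\<bar> \<le> int M}"

definition Pi_hat_space :: "nat \<Rightarrow> nat \<Rightarrow> laurent set" where
  "Pi_hat_space N M = lspan {(i, j). 0 \<le> i \<and> i \<le> int N \<and> 0 \<le> j \<and> j \<le> int M}"

text \<open>
  The coefficient of \<open>z\<^sup>i w\<^sup>j\<close> in the dagger of p is the conjugate of the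
  coefficient of \<open>z\<^sup>-\<^sup>i w\<^sup>-\<^sup>j\<close> in p; lemma \<open>leval_ldagger\<close> below
  relates this to the pointwise description.
\<close>

definition ldagger :: "laurent \<Rightarrow> laurent" where
  "ldagger p = Poly_Mapping.map_key uminus (Poly_Mapping.map cnj p)"

definition leval :: "laurent \<Rightarrow> complex \<Rightarrow> complex \<Rightarrow> complex" where
  "leval p z w = (\<Sum>(i, j)\<in>Poly_Mapping.keys p. lcoeff p (i, j) * z powi i * w powi j)"

lemma lcoeff_ldagger [simp]: "lcoeff (ldagger p) (i, j) = cnj (lcoeff p (-i, -j))"
proof -
  have "inj (uminus :: int \<times> int \<Rightarrow> int \<times> int)"
    by (rule injI) simp
  then show ?thesis
    by (simp add: ldagger_def map_key.rep_eq Poly_Mapping.map.rep_eq when_def)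
qed

lemma leval_ldagger: "leval (ldagger p) z w = cnj (leval p (1 / cnj z) (1 / cnj w))"
proof -
  have "leval (ldagger p) z w =
      (\<Sum>(i, j)\<in>Poly_Mapping.keys p. lcoeff (ldagger p) (-i, -j) * z powi (-i) * w powi (-j))"
    unfolding leval_def
    by (rule sum.reindex_bij_witness[of _ uminus uminus])
      (auto simp: in_keys_iff)
  also have "\<dots> = cnj (leval p (1 / cnj z) (1 / cnj w))"
    unfolding leval_def cnj_sum
    by (rule sum.cong)
      (auto simp: power_int_minus power_int_divide_distrib inverse_eq_divide)
  finally show ?thesis .
qed

text \<open>
  The functional is total on \<^typ>\<open>laurent\<close>, but only its values on the space spanned by the
  monomials with exponents bounded by N, M are constrained. In \<^theory>\<open>HOL-Library.Complex_Order\<close>,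
  \<open>0 < c\<close> for complex c says that c is real and strictly positive.
\<close>

definition linear_functional_on :: "laurent set \<Rightarrow> (laurent \<Rightarrow> complex) \<Rightarrow> bool" where
  "linear_functional_on V L \<longleftrightarrow>
     (\<forall>p\<in>V. \<forall>q\<in>V. L (p + q) = L p + L q) \<and>
     (\<forall>c. \<forall>p\<in>V. L (lscale c p) = c * L p)"

definition positive_definite_functional :: "nat \<Rightarrow> nat \<Rightarrow> (laurent \<Rightarrow> complex) \<Rightarrow> bool" where
  "positive_definite_functional N M L \<longleftrightarrow>
     linear_functional_on (Pi_space N M) L \<and>
     (\<forall>i j. \<bar>i\<bar> \<le> int N \<longrightarrow> \<bar>j\<bar> \<le> int M \<longrightarrow> L (lmonom (-i, -j)) = cnj (L (lmonom (i, j)))) \<and>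
     (\<forall>p\<in>Pi_hat_space N M. p \<noteq> 0 \<longrightarrow> 0 < L (p * ldagger p))"

text \<open>Column vectors of Laurent polynomials are matrices with one column.\<close>

definition mat_ldagger :: "laurent mat \<Rightarrow> laurent mat" where
  "mat_ldagger Q = map_mat ldagger (transpose_mat Q)"

definition inner_mat :: "(laurent \<Rightarrow> complex) \<Rightarrow> laurent mat \<Rightarrow> laurent mat \<Rightarrow> complex mat" where
  "inner_mat L X Y = map_mat L (X * mat_ldagger Y)"

definition inner_scalar :: "(laurent \<Rightarrow> complex) \<Rightarrow> laurent \<Rightarrow> laurent \<Rightarrow> complex" where
  "inner_scalar L p q = L (p * ldagger q)"

definition is_orthonormal_with_leading ::
  "(laurent \<Rightarrow> complex) \<Rightarrow> (int \<times> int) set \<Rightarrow> int \<times> int \<Rightarrow> laurent \<Rightarrow> bool" where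
  "is_orthonormal_with_leading L S k p \<longleftrightarrow>
     p \<in> lspan S \<and> 0 < lcoeff p k \<and> inner_scalar L p p = 1 \<and>
     (\<forall>k'\<in>S - {k}. inner_scalar L p (lmonom k') = 0)"

definition phi :: "(laurent \<Rightarrow> complex) \<Rightarrow> nat \<Rightarrow> nat \<Rightarrow> nat \<Rightarrow> laurent" where
  "phi L n m l = (THE p. is_orthonormal_with_leading L
     ({(i, j). 0 \<le> i \<and> i < int n \<and> 0 \<le> j \<and> j \<le> int m} \<union>
      {(i, j). i = int n \<and> 0 \<le> j \<and> j \<le> int l})
     (int n, int l) p)"

definition phi_tilde :: "(laurent \<Rightarrow> complex) \<Rightarrow> nat \<Rightarrow> nat \<Rightarrow> nat \<Rightarrow> laurent" where
  "phi_tilde L n m l = (THE p. is_orthonormal_with_leading L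
     ({(i, j). 0 \<le> i \<and> i \<le> int n \<and> 0 \<le> j \<and> j < int m} \<union>
      {(i, j). 0 \<le> i \<and> i \<le> int l \<and> j = int m})
     (int l, int m) p)"

text \<open>The superscripts decrease from top to bottom.\<close>

definition Phi :: "(laurent \<Rightarrow> complex) \<Rightarrow> nat \<Rightarrow> nat \<Rightarrow> laurent mat" where
  "Phi L n m = mat (m + 1) 1 (\<lambda>(r, _). phi L n m (m - r))"

definition Phi_tilde :: "(laurent \<Rightarrow> complex) \<Rightarrow> nat \<Rightarrow> nat \<Rightarrow> laurent mat" where
  "Phi_tilde L n m = mat (n + 1) 1 (\<lambda>(r, _). phi_tilde L n m (n - r))"

definition reversal :: "nat \<Rightarrow> nat \<Rightarrow> laurent mat \<Rightarrow> laurent mat" where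
  "reversal n m X = lmonom (int n, int m) \<cdot>\<^sub>m mat_ldagger X"

abbreviation z_times :: "laurent mat \<Rightarrow> laurent mat" where
  "z_times X \<equiv> lmonom (1, 0) \<cdot>\<^sub>m X"

abbreviation w_times :: "laurent mat \<Rightarrow> laurent mat" where
  "w_times X \<equiv> lmonom (0, 1) \<cdot>\<^sub>m X"

definition E_hat :: "(laurent \<Rightarrow> complex) \<Rightarrow> nat \<Rightarrow> nat \<Rightarrow> complex mat" where
  "E_hat L n m = inner_mat L (z_times (Phi L (n - 1) m))
     (transpose_mat (reversal (n - 1) m (Phi L (n - 1) m)))"

definition A_mat :: "(laurent \<Rightarrow> complex) \<Rightarrow> nat \<Rightarrow> nat \<Rightarrow> complex mat" where
  "A_mat L n m = inner_mat L (z_times (Phi L (n - 1) m)) (Phi L n m)"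

definition K_mat :: "(laurent \<Rightarrow> complex) \<Rightarrow> nat \<Rightarrow> nat \<Rightarrow> complex mat" where
  "K_mat L n m = inner_mat L (Phi L n (m - 1)) (Phi_tilde L (n - 1) m)"

definition K1_mat :: "(laurent \<Rightarrow> complex) \<Rightarrow> nat \<Rightarrow> nat \<Rightarrow> complex mat" where
  "K1_mat L n m = inner_mat L (w_times (Phi L n (m - 1)))
     (transpose_mat (reversal (n - 1) m (Phi_tilde L (n - 1) m)))"

definition Gamma_mat :: "(laurent \<Rightarrow> complex) \<Rightarrow> nat \<Rightarrow> nat \<Rightarrow> complex mat" where
  "Gamma_mat L n m = inner_mat L (Phi L n (m - 1)) (Phi L n m)"

definition Gamma1_mat :: "(laurent \<Rightarrow> complex) \<Rightarrow> nat \<Rightarrow> nat \<Rightarrow> complex mat" where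
  "Gamma1_mat L n m = inner_mat L (w_times (Phi L n (m - 1))) (Phi L n m)"

definition I_mat :: "(laurent \<Rightarrow> complex) \<Rightarrow> nat \<Rightarrow> nat \<Rightarrow> complex mat" where
  "I_mat L n m = inner_mat L (Phi L n m) (Phi_tilde L n m)"

definition I1_mat :: "(laurent \<Rightarrow> complex) \<Rightarrow> nat \<Rightarrow> nat \<Rightarrow> complex mat" where
  "I1_mat L n m = inner_mat L (transpose_mat (reversal n m (Phi L n m))) (Phi_tilde L n m)"

end

theory Submission
  imports Defs
begin

text \<open>
  Let \<open>H\<^sub>n\<^sub>,\<^sub>m\<close> be the span of the \<open>z\<^sup>i w\<^sup>j\<close> with
  \<open>0 \<le> i \<le> n\<close>, \<open>0 \<le> j \<le> m\<close>. Gram--Schmidt makes the entries of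
  \<open>\<Phi>\<^sub>n\<^sub>,\<^sub>m\<close> an orthonormal basis of the complement of
  \<open>H\<^sub>n\<^sub>-\<^sub>1\<^sub>,\<^sub>m\<close> in \<open>H\<^sub>n\<^sub>,\<^sub>m\<close>, and the second family one of the
  complement of \<open>H\<^sub>n\<^sub>,\<^sub>m\<^sub>-\<^sub>1\<close>. Write \<open>k = n - 1\<close>, and let \<open>R\<^sub>k\<^sub>,\<^sub>m\<close> be the
  column of reversals of the entries of \<open>\<Phi>\<^sub>k\<^sub>,\<^sub>m\<close>.

  The key step is the recurrence
  \<open>z \<Phi>\<^sub>k\<^sub>,\<^sub>m\<^sub>-\<^sub>1 = A \<Phi>\<^sub>n\<^sub>,\<^sub>m\<^sub>-\<^sub>1 + E R\<^sub>k\<^sub>,\<^sub>m\<^sub>-\<^sub>1\<close>: what is left after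
  projecting on \<open>\<Phi>\<^sub>n\<^sub>,\<^sub>m\<^sub>-\<^sub>1\<close> lies in \<open>H\<^sub>k\<^sub>,\<^sub>m\<^sub>-\<^sub>1\<close> and is orthogonal to
  \<open>z H\<^sub>k\<^sub>-\<^sub>1\<^sub>,\<^sub>m\<^sub>-\<^sub>1\<close>, hence is a combination of reversals. For \<open>p\<close> in \<open>H\<^sub>k\<^sub>,\<^sub>m\<close> the
  functional \<open>p \<mapsto> \<langle>z p, R\<^sub>k\<^sub>,\<^sub>m\<rangle>\<close> vanishes on \<open>H\<^sub>k\<^sub>-\<^sub>1\<^sub>,\<^sub>m\<close>, so expanding \<open>p\<close>
  in \<open>\<Phi>\<^sub>k\<^sub>,\<^sub>m\<close> does not lose anything. With \<open>p\<close> an entry of \<open>\<Phi>\<^sub>k\<^sub>,\<^sub>m\<^sub>-\<^sub>1\<close> this turns the left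
  side of the first relation into \<open>\<langle>z \<Phi>\<^sub>k\<^sub>,\<^sub>m\<^sub>-\<^sub>1, R\<^sub>k\<^sub>,\<^sub>m\<rangle>\<close>; with \<open>p\<close> an entry of
  \<open>w \<Phi>\<^sub>k\<^sub>,\<^sub>m\<^sub>-\<^sub>1\<close>, and since E is symmetric, it turns the left side of the second into
  the transpose of \<open>\<langle>z w \<Phi>\<^sub>k\<^sub>,\<^sub>m\<^sub>-\<^sub>1, R\<^sub>k\<^sub>,\<^sub>m\<rangle>\<close>. Both then follow from the recurrence.
\<close>


subsection \<open>Laurent polynomials\<close>

lemma lcoeff_lscale [simp]: "lcoeff (lscale c p) k = c * lcoeff p k"
proof -
  have "lscale c p = Poly_Mapping.map ((*) c) p"
    unfolding lscale_def by (metis mult_map_scale_conv_mult)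
  then show ?thesis
    by (simp add: Poly_Mapping.map.rep_eq when_def)
qed

lemma lcoeff_lmonom: "lcoeff (lmonom k) k' = (if k = k' then 1 else 0)"
  by (simp add: lmonom_def lookup_single when_def)

lemma keys_lmonom [simp]: "Poly_Mapping.keys (lmonom k) = {k}"
  by (simp add: lmonom_def)

lemma laurent_eq_sum_lmonom:
  "p = (\<Sum>k\<in>Poly_Mapping.keys p. lscale (lcoeff p k) (lmonom k))"
  by (rule poly_mapping_eqI)
    (auto simp: lookup_sum lcoeff_lmonom in_keys_iff if_distrib sum.delta cong: if_cong)

text \<open>Monomials form a basis, so span membership is a condition on the support. Closure of
  spans under products, shifts, daggers and reversals thereby reduces to arithmetic of
  exponents.\<close>

lemma lspan_iff_keys: "p \<in> lspan S \<longleftrightarrow> Poly_Mapping.keys p \<subseteq> S"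
proof
  assume "p \<in> lspan S"
  then show "Poly_Mapping.keys p \<subseteq> S"
    unfolding lspan_def
  proof (induction rule: laurent.span_induct_alt)
    case (step c x y)
    then obtain k where "k \<in> S" "x = lmonom k"
      by auto
    with step.IH show ?case
      by (auto simp: in_keys_iff lookup_add lcoeff_lmonom split: if_splits)
  qed simp
next
  assume "Poly_Mapping.keys p \<subseteq> S"
  then have "(\<Sum>k\<in>Poly_Mapping.keys p. lscale (lcoeff p k) (lmonom k)) \<in> lspan S"
    unfolding lspan_def
    by (intro laurent.span_sum laurent.span_scale laurent.span_base) auto
  then show "p \<in> lspan S"
    using laurent_eq_sum_lmonom[of p] by simp
qed

lemma lspan_closed:
  "0 \<in> lspan S" "lmonom k \<in> lspan S \<longleftrightarrow> k \<in> S"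
  "p \<in> lspan S \<Longrightarrow> q \<in> lspan S \<Longrightarrow> p + q \<in> lspan S"
  "p \<in> lspan S \<Longrightarrow> q \<in> lspan S \<Longrightarrow> p - q \<in> lspan S"
  "p \<in> lspan S \<Longrightarrow> lscale c p \<in> lspan S"
  "(\<And>i. i \<in> I \<Longrightarrow> f i \<in> lspan S) \<Longrightarrow> sum f I \<in> lspan S"
  by (simp_all add: lspan_iff_keys)
    (auto simp: lspan_def intro: laurent.span_zero laurent.span_add laurent.span_diff
      laurent.span_scale laurent.span_sum simp flip: lspan_iff_keys)

lemma lspan_mono: "p \<in> lspan S \<Longrightarrow> S \<subseteq> T \<Longrightarrow> p \<in> lspan T"
  by (auto simp: lspan_iff_keys)

lemma lspan_mult:
  assumes "p \<in> lspan S" "q \<in> lspan T" "\<And>a b. a \<in> S \<Longrightarrow> b \<in> T \<Longrightarrow> a + b \<in> U"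
  shows "p * q \<in> lspan U"
  using assms keys_mult[of p q] by (fastforce simp: lspan_iff_keys)

lemma lspan_ldagger: "p \<in> lspan S \<Longrightarrow> ldagger p \<in> lspan (uminus ` S)"
  unfolding lspan_iff_keys
proof
  fix k assume "Poly_Mapping.keys p \<subseteq> S" "k \<in> Poly_Mapping.keys (ldagger p)"
  then have "- k \<in> S"
    by (cases k) (auto simp: in_keys_iff)
  then show "k \<in> uminus ` S"
    by (rule rev_image_eqI) simp
qed

lemma lmonom_mult: "lmonom a * lmonom b = lmonom (a + b)"
  by (simp add: lmonom_def mult_single)

lemma lmonom_zero [simp]: "lmonom 0 = 1"
  by (simp add: lmonom_def)

lemma lscale_mult: "lscale c p * q = lscale c (p * q)" "q * lscale c p = lscale c (q * p)"
  by (simp_all add: lscale_def algebra_simps)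

lemma ldagger_add: "ldagger (p + q) = ldagger p + ldagger q"
  by (rule poly_mapping_eqI) (auto simp: lookup_add)

lemma ldagger_lscale: "ldagger (lscale c p) = lscale (cnj c) (ldagger p)"
  by (rule poly_mapping_eqI) auto

lemma ldagger_zero [simp]: "ldagger 0 = 0"
  by (rule poly_mapping_eqI) auto

lemma ldagger_sum: "ldagger (sum f I) = (\<Sum>i\<in>I. ldagger (f i))"
  by (induction I rule: infinite_finite_induct) (auto simp: ldagger_add)

lemma ldagger_lmonom: "ldagger (lmonom k) = lmonom (- k)"
  by (rule poly_mapping_eqI) (cases k; auto simp: lcoeff_lmonom split: if_splits)

lemma ldagger_ldagger [simp]: "ldagger (ldagger p) = p"
  by (rule poly_mapping_eqI) auto

lemma ldagger_mult: "ldagger (p * q) = ldagger p * ldagger q"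
proof -
  have *: "ldagger (lmonom a * lmonom b) = ldagger (lmonom a) * ldagger (lmonom b)" for a b
    by (simp add: lmonom_mult ldagger_lmonom)
  have "ldagger (lmonom a * q) = ldagger (lmonom a) * ldagger q" for a
    by (subst (1 2) laurent_eq_sum_lmonom[of q])
      (simp add: sum_distrib_left ldagger_sum lscale_mult ldagger_lscale *)
  then show ?thesis
    by (subst (1 2) laurent_eq_sum_lmonom[of p])
      (simp add: sum_distrib_right ldagger_sum lscale_mult ldagger_lscale)
qed

subsection \<open>The inner product and Gram--Schmidt\<close>

text \<open>The bounds are half-open, so \<open>box n (Suc m)\<close> encodes the exponents of the
  previous level in z without subtraction, and is empty for \<open>n = 0\<close>.\<close>

definition box :: "nat \<Rightarrow> nat \<Rightarrow> (int \<times> int) set" where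
  "box a b = {0..<int a} \<times> {0..<int b}"

lemma finite_box: "finite (box a b)"
  by (simp add: box_def)

lemma box_mono: "a \<le> a' \<Longrightarrow> b \<le> b' \<Longrightarrow> box a b \<subseteq> box a' b'"
  by (auto simp: box_def)

lemma Pi_hat_space_eq_box: "Pi_hat_space N M = lspan (box (Suc N) (Suc M))"
  unfolding Pi_hat_space_def box_def by (rule arg_cong[of _ _ lspan]) auto

lemma positive_complexE:
  fixes c :: complex
  assumes "0 < c"
  obtains r where "0 < r" "c = complex_of_real r"
  using assms by (intro that[of "Re c"]) (auto simp: less_complex_def complex_eq_iff)

locale pd_functional =
  fixes L :: "laurent \<Rightarrow> complex" and N M :: nat
  assumes pd: "positive_definite_functional N M L"
begin

abbreviation ip :: "laurent \<Rightarrow> laurent \<Rightarrow> complex" where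
  "ip \<equiv> inner_scalar L"

abbreviation V :: "laurent set" where
  "V \<equiv> lspan (box (Suc N) (Suc M))"

lemma L_add: "p \<in> Pi_space N M \<Longrightarrow> q \<in> Pi_space N M \<Longrightarrow> L (p + q) = L p + L q"
  and L_scale: "p \<in> Pi_space N M \<Longrightarrow> L (lscale c p) = c * L p"
  using pd by (auto simp: positive_definite_functional_def linear_functional_on_def)

text \<open>Hermitian symmetry is given only on monomials and extends by linearity. Since
  \<open>L\<close> is linear only on \<open>Pi_space N M\<close>, the induction also carries
  membership of \<open>p\<close> and of its dagger.\<close>

lemma L_ldagger: "p \<in> Pi_space N M \<Longrightarrow> L (ldagger p) = cnj (L p)"
proof -
  assume "p \<in> Pi_space N M"
  then have "L (ldagger p) = cnj (L p) \<and> p \<in> Pi_space N M \<and> ldagger p \<in> Pi_space N M"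
    unfolding Pi_space_def lspan_def
  proof (induction rule: laurent.span_induct_alt)
    case base
    have "L 0 = 0"
      using L_scale[of 0 0] by (simp add: Pi_space_def lspan_closed(1) lscale_def)
    then show ?case
      by (simp add: laurent.span_zero)
  next
    case (step c x y)
    then obtain i j where ij: "x = lmonom (i, j)" "\<bar>i\<bar> \<le> int N" "\<bar>j\<bar> \<le> int M"
      by auto
    then have x: "x \<in> Pi_space N M" "ldagger x \<in> Pi_space N M" "L (ldagger x) = cnj (L x)"
      using pd by (auto simp: Pi_space_def lspan_closed ldagger_lmonom positive_definite_functional_def)
    have y: "y \<in> Pi_space N M" "ldagger y \<in> Pi_space N M" "L (ldagger y) = cnj (L y)"
      using step.IH by (auto simp: Pi_space_def lspan_def)
    have scaled: "lscale a x \<in> Pi_space N M" "lscale a (ldagger x) \<in> Pi_space N M" for a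
      using x by (auto simp: Pi_space_def lspan_closed)
    have "L (ldagger (lscale c x + y)) = cnj (L (lscale c x + y))"
      using x y scaled by (simp add: ldagger_add ldagger_lscale L_add L_scale)
    moreover have "lscale c x + y \<in> Pi_space N M" "ldagger (lscale c x + y) \<in> Pi_space N M"
      using y scaled by (auto simp: Pi_space_def lspan_closed ldagger_add ldagger_lscale)
    ultimately show ?case
      by (simp add: Pi_space_def lspan_def)
  qed
  then show ?thesis by simp
qed

text \<open>Differences of two exponents from the box stay within the bounds N and M in absolute
  value, so \<open>ip\<close> is sesquilinear on \<open>V\<close>.\<close>

lemma mult_ldagger_in_Pi_space:
  assumes "p \<in> V" "q \<in> V"
  shows "p * ldagger q \<in> Pi_space N M"
  unfolding Pi_space_def
  by (rule lspan_mult[OF assms(1) lspan_ldagger[OF assms(2)]]) (auto simp: box_def)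

lemma ip_add_left: "p \<in> V \<Longrightarrow> q \<in> V \<Longrightarrow> r \<in> V \<Longrightarrow> ip (p + q) r = ip p r + ip q r"
  by (simp add: inner_scalar_def distrib_right L_add mult_ldagger_in_Pi_space)

lemma ip_scale_left: "p \<in> V \<Longrightarrow> r \<in> V \<Longrightarrow> ip (lscale c p) r = c * ip p r"
  by (simp add: inner_scalar_def lscale_mult L_scale mult_ldagger_in_Pi_space)

lemma ip_zero_left: "r \<in> V \<Longrightarrow> ip 0 r = 0"
  using ip_scale_left[of 0 r 0] by (simp add: lscale_def lspan_closed)

lemma ip_diff_left: "p \<in> V \<Longrightarrow> q \<in> V \<Longrightarrow> r \<in> V \<Longrightarrow> ip (p - q) r = ip p r - ip q r"
  using ip_add_left[of "p - q" q r] by (simp add: lspan_closed)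

lemma ip_sum_left:
  assumes "\<And>i. i \<in> I \<Longrightarrow> f i \<in> V" "r \<in> V"
  shows "ip (\<Sum>i\<in>I. lscale (c i) (f i)) r = (\<Sum>i\<in>I. c i * ip (f i) r)"
  using assms(1)
proof (induction I rule: infinite_finite_induct)
  case (insert i I)
  then have "lscale (c i) (f i) \<in> V" "(\<Sum>i\<in>I. lscale (c i) (f i)) \<in> V"
    by (auto intro!: lspan_closed)
  with insert show ?case
    by (simp add: ip_add_left ip_scale_left assms(2))
qed (simp_all add: ip_zero_left assms(2))

lemma ip_commute: "p \<in> V \<Longrightarrow> q \<in> V \<Longrightarrow> ip q p = cnj (ip p q)"
  using L_ldagger[OF mult_ldagger_in_Pi_space[of p q]]
  by (simp add: inner_scalar_def ldagger_mult mult.commute)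

lemma ip_pos: "p \<in> V \<Longrightarrow> p \<noteq> 0 \<Longrightarrow> 0 < ip p p"
  using pd by (auto simp: positive_definite_functional_def inner_scalar_def Pi_hat_space_eq_box)

lemma ip_eq_zero_of_monomials:
  assumes "p \<in> V" "q \<in> lspan S" "S \<subseteq> box (Suc N) (Suc M)"
    and "\<And>k. k \<in> S \<Longrightarrow> ip p (lmonom k) = 0"
  shows "ip p q = 0"
proof -
  let ?K = "Poly_Mapping.keys q"
  have K: "k \<in> S" "lmonom k \<in> V" if "k \<in> ?K" for k
    using assms(2,3) that by (auto simp: lspan_iff_keys)
  have "ip q p = ip (\<Sum>k\<in>?K. lscale (lcoeff q k) (lmonom k)) p"
    using laurent_eq_sum_lmonom[of q] by simp
  also have "\<dots> = (\<Sum>k\<in>?K. lcoeff q k * ip (lmonom k) p)"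
    by (rule ip_sum_left) (use K assms(1) in auto)
  also have "\<dots> = 0"
  proof (rule sum.neutral, rule ballI)
    fix k assume "k \<in> ?K"
    then have "ip (lmonom k) p = cnj (ip p (lmonom k))"
      using K assms(1) by (intro ip_commute) auto
    then show "lcoeff q k * ip (lmonom k) p = 0"
      using assms(4) K(1)[OF \<open>k \<in> ?K\<close>] by simp
  qed
  finally show ?thesis
    using ip_commute[of q p] assms(1,2,3) by (simp add: lspan_mono)
qed

text \<open>Induction on \<open>T\<close>: the monomial at the new exponent \<open>t\<close>, minus
  its projection on the old span, is a vector \<open>u\<close> orthogonal to that span. It is
  nonzero because its coefficient at \<open>t\<close> is 1, so a multiple of \<open>u\<close>
  corrects the old projection of \<open>x\<close>.\<close>

lemma projection_exists:
  assumes "finite T" "T \<subseteq> box (Suc N) (Suc M)" "x \<in> V"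
  shows "\<exists>y\<in>lspan T. \<forall>t\<in>T. ip (x - y) (lmonom t) = 0"
  using assms
proof (induction T arbitrary: x)
  case empty
  then show ?case by (auto intro: lspan_closed(1))
next
  case (insert t T)
  have tV: "lmonom t \<in> V"
    using insert.prems by (simp add: lspan_closed)
  have TV: "lmonom s \<in> V" if "s \<in> T" for s
    using insert.prems that by (auto simp: lspan_closed)
  obtain u0 where u0: "u0 \<in> lspan T" "\<And>s. s \<in> T \<Longrightarrow> ip (lmonom t - u0) (lmonom s) = 0"
    using insert.IH[OF _ tV] insert.prems by auto
  obtain y where y: "y \<in> lspan T" "\<And>s. s \<in> T \<Longrightarrow> ip (x - y) (lmonom s) = 0"
    using insert.IH[OF _ insert.prems(2)] insert.prems by auto
  define u where "u = lmonom t - u0"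
  have [simp]: "u0 \<in> V" "y \<in> V"
    using u0(1) y(1) insert.prems by (auto elim!: lspan_mono)
  have [simp]: "u \<in> V" "x - y \<in> V"
    using tV insert.prems(2) by (auto simp: u_def lspan_closed)
  have "lcoeff u t = 1"
    using u0(1) insert.hyps by (auto simp: u_def lookup_minus lcoeff_lmonom lspan_iff_keys in_keys_iff)
  then have "u \<noteq> 0" by auto
  then have "ip u u \<noteq> 0"
    using ip_pos[of u] by auto
  moreover have "ip u u0 = 0"
    using u0 insert.prems by (intro ip_eq_zero_of_monomials[of u u0 T]) (auto simp flip: u_def)
  then have "ip u0 u = 0"
    using ip_commute[of u u0] by simp
  then have "ip (lmonom t) u = ip u u"
    using ip_diff_left[of "lmonom t" u0 u] tV by (simp add: u_def[symmetric])
  ultimately have nz: "ip u (lmonom t) \<noteq> 0"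
    using ip_commute[of "lmonom t" u] tV by auto
  define c where "c = ip (x - y) (lmonom t) / ip u (lmonom t)"
  have "u \<in> lspan (insert t T)" "y \<in> lspan (insert t T)"
    using u0(1) y(1) by (auto simp: u_def lspan_closed intro!: lspan_closed(4) elim: lspan_mono)
  then have "y + lscale c u \<in> lspan (insert t T)"
    by (intro lspan_closed)
  moreover have "ip (x - (y + lscale c u)) (lmonom s) = 0" if "s \<in> insert t T" for s
  proof -
    have sV: "lmonom s \<in> V" "lscale c u \<in> V"
      using that tV TV by (metis insert_iff, simp add: lspan_closed(5))
    have "ip ((x - y) - lscale c u) (lmonom s) = ip (x - y) (lmonom s) - c * ip u (lmonom s)"
      using ip_diff_left[OF _ sV(2,1), of "x - y"] ip_scale_left[OF _ sV(1), of u c] by simp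
    also have "\<dots> = 0"
      using that y(2)[of s] u0(2)[of s] nz by (cases "s = t") (simp_all add: c_def flip: u_def)
    finally show ?thesis by (simp add: algebra_simps)
  qed
  ultimately show ?case by blast
qed

text \<open>The leading monomial minus its projection on the other monomials has leading coefficient
  1. Division by its norm, a positive real, keeps that coefficient positive.\<close>

lemma orthonormal_with_leading_exists:
  assumes "k \<in> S" "S \<subseteq> box (Suc N) (Suc M)"
  shows "\<exists>p. is_orthonormal_with_leading L S k p"
proof -
  have S: "finite (S - {k})" "S - {k} \<subseteq> box (Suc N) (Suc M)"
    using assms(2) finite_box finite_subset by blast+
  have kV: "lmonom k \<in> V"
    using assms by (auto simp: lspan_closed)
  obtain y where y: "y \<in> lspan (S - {k})" "\<And>t. t \<in> S - {k} \<Longrightarrow> ip (lmonom k - y) (lmonom t) = 0"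
    using projection_exists[OF S kV] by auto
  define u where "u = lmonom k - y"
  have uS: "u \<in> lspan S"
    unfolding u_def by (intro lspan_closed lspan_mono[OF y(1)]) (use assms(1) in \<open>auto simp: lspan_closed\<close>)
  then have uV: "u \<in> V"
    using assms(2) by (rule lspan_mono)
  have u1: "lcoeff u k = 1"
    using y(1) by (auto simp: u_def lookup_minus lcoeff_lmonom lspan_iff_keys in_keys_iff)
  then have "0 < ip u u"
    using uV by (intro ip_pos) auto
  then obtain r where r: "0 < r" "ip u u = complex_of_real r"
    by (rule positive_complexE)
  define d where "d = complex_of_real (1 / sqrt r)"
  have d: "0 < d" "d * cnj d * complex_of_real r = 1"
    using r(1) by (auto simp: d_def less_complex_def simp flip: of_real_mult)
  have dV: "lscale d u \<in> V"
    using uV by (rule lspan_closed)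
  have "ip u (lscale d u) = cnj d * ip u u"
    using ip_commute[OF dV uV] ip_commute[OF uV uV] uV by (simp add: ip_scale_left)
  then have "ip (lscale d u) (lscale d u) = 1"
    using uV dV d(2) r(2) by (simp add: ip_scale_left mult_ac)
  moreover have "ip (lscale d u) (lmonom t) = 0" if "t \<in> S - {k}" for t
    using that y(2)[OF that] S(2) uV by (subst ip_scale_left) (auto simp: lspan_closed u_def)
  ultimately have "is_orthonormal_with_leading L S k (lscale d u)"
    using uS u1 d(1) by (simp add: is_orthonormal_with_leading_def lspan_closed)
  then show ?thesis ..
qed

text \<open>Cross-multiplying by the leading coefficients cancels the leading term, leaving a vector
  in the span of the remaining monomials and orthogonal to it, hence zero. Equal norms and
  positivity then force equal leading coefficients.\<close>

lemma orthonormal_with_leading_unique: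
  assumes S: "S \<subseteq> box (Suc N) (Suc M)"
    and p: "is_orthonormal_with_leading L S k p" and q: "is_orthonormal_with_leading L S k q"
  shows "p = q"
proof -
  define a b where "a = lcoeff p k" and "b = lcoeff q k"
  have ab: "0 < a" "0 < b"
    using p q by (auto simp: a_def b_def is_orthonormal_with_leading_def)
  have pq: "p \<in> lspan S" "q \<in> lspan S" "p \<in> V" "q \<in> V" "ip p p = 1" "ip q q = 1"
    using p q S by (auto simp: is_orthonormal_with_leading_def elim: lspan_mono)
  define h where "h = lscale b p - lscale a q"
  have "h \<in> lspan S"
    unfolding h_def by (intro lspan_closed pq)
  moreover have "lcoeff h k = 0"
    by (simp add: h_def lookup_minus a_def b_def)
  ultimately have hS: "h \<in> lspan (S - {k})"
    by (auto simp: lspan_iff_keys in_keys_iff)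
  then have hV: "h \<in> V"
    using S by (auto elim: lspan_mono)
  have "ip h (lmonom t) = 0" if "t \<in> S - {k}" for t
  proof -
    have "lmonom t \<in> V" using that S by (auto simp: lspan_closed)
    then have "ip h (lmonom t) = b * ip p (lmonom t) - a * ip q (lmonom t)"
      unfolding h_def using pq by (subst ip_diff_left) (auto simp: ip_scale_left lspan_closed)
    then show ?thesis
      using p q that by (simp add: is_orthonormal_with_leading_def)
  qed
  then have "ip h h = 0"
    using hV hS S by (intro ip_eq_zero_of_monomials[of h h "S - {k}"]) auto
  then have "h = 0"
    using ip_pos[OF hV] by auto
  then have eq: "lscale b p = lscale a q"
    by (simp add: h_def)
  have norm: "ip (lscale c x) (lscale c x) = c * cnj c" if "x \<in> V" "ip x x = 1" for c x
  proof -
    have cV: "lscale c x \<in> V" using that(1) by (rule lspan_closed)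
    then have "ip x (lscale c x) = cnj c"
      using ip_commute[OF cV that(1)] that by (simp add: ip_scale_left)
    then show ?thesis
      using that cV by (simp add: ip_scale_left)
  qed
  have "b * cnj b = a * cnj a"
    using norm[OF pq(3,5), of b] norm[OF pq(4,6), of a] eq by simp
  moreover obtain a' b' where a': "a = complex_of_real a'" "b = complex_of_real b'" "0 < a'" "0 < b'"
    using ab by (metis positive_complexE)
  ultimately have "complex_of_real (b'\<^sup>2) = complex_of_real (a'\<^sup>2)"
    by (simp add: power2_eq_square)
  then have "b'\<^sup>2 = a'\<^sup>2"
    by (simp only: of_real_eq_iff)
  then have "a = b"
    using a' by (simp add: power2_eq_iff_nonneg)
  then show ?thesis
    using eq ab by (auto simp: poly_mapping_eq_iff fun_eq_iff dest!: arg_cong[of _ _ lcoeff] fun_cong)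
qed

lemma orthonormal_with_leading_the:
  assumes "k \<in> S" "S \<subseteq> box (Suc N) (Suc M)"
  shows "is_orthonormal_with_leading L S k (THE p. is_orthonormal_with_leading L S k p)"
  using orthonormal_with_leading_exists[OF assms] orthonormal_with_leading_unique[OF assms(2)]
  by (metis the_equality)

end

subsection \<open>Reversals and orthonormal expansions\<close>

text \<open>Scalar counterpart of \<open>reversal\<close>; it sends the exponent
  \<open>(i, j)\<close> to \<open>(a - i, b - j)\<close> and conjugates coefficients.\<close>

definition reverse_poly :: "nat \<Rightarrow> nat \<Rightarrow> laurent \<Rightarrow> laurent" where
  "reverse_poly a b p = lmonom (int a, int b) * ldagger p"

lemma reverse_poly_reverse_poly [simp]: "reverse_poly a b (reverse_poly a b p) = p"
  by (simp add: reverse_poly_def ldagger_mult ldagger_lmonom lmonom_mult zero_prod_def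
      flip: mult.assoc) (simp flip: zero_prod_def)

lemma lspan_lmonom_mult:
  "p \<in> lspan S \<Longrightarrow> (\<And>a. a \<in> S \<Longrightarrow> k + a \<in> U) \<Longrightarrow> lmonom k * p \<in> lspan U"
  by (rule lspan_mult[of _ "{k}" _ S]) (auto simp: lspan_closed)

lemma lspan_reverse_poly:
  "p \<in> lspan S \<Longrightarrow> (\<And>i j. (i, j) \<in> S \<Longrightarrow> (int a - i, int b - j) \<in> U) \<Longrightarrow> reverse_poly a b p \<in> lspan U"
  unfolding reverse_poly_def
  by (rule lspan_lmonom_mult[OF lspan_ldagger]) auto

lemma reverse_poly_box:
  "p \<in> lspan (box (Suc a) (Suc b)) \<Longrightarrow> reverse_poly a b p \<in> lspan (box (Suc a) (Suc b))"
  by (rule lspan_reverse_poly) (auto simp: box_def)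

lemma inner_scalar_lmonom_mult_left:
  "inner_scalar L (lmonom a * p) q = L (lmonom a * (p * ldagger q))"
  by (simp add: inner_scalar_def mult_ac)

lemma inner_scalar_lmonom_mult_right:
  "inner_scalar L p (lmonom b * q) = L (lmonom (- b) * (p * ldagger q))"
  by (simp add: inner_scalar_def ldagger_mult ldagger_lmonom mult_ac)

lemma inner_scalar_lmonom_mult:
  "inner_scalar L (lmonom a * p) (lmonom b * q) = L (lmonom (a - b) * (p * ldagger q))"
proof -
  have "lmonom a * p * ldagger (lmonom b * q) = (lmonom a * lmonom (- b)) * (p * ldagger q)"
    by (simp add: ldagger_mult ldagger_lmonom mult_ac)
  then show ?thesis
    by (simp add: inner_scalar_def lmonom_mult)
qed

text \<open>In each identity both sides apply \<open>L\<close> to the same Laurent polynomial: a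
  monomial times \<open>p * q\<close> in the first, times the product of the two daggers in the
  second.\<close>

lemma inner_scalar_reverse_poly_swap:
  "inner_scalar L p (reverse_poly a b q) = inner_scalar L q (reverse_poly a b p)"
  "inner_scalar L (reverse_poly a b p) q = inner_scalar L (reverse_poly a b q) p"
  by (simp_all add: reverse_poly_def inner_scalar_lmonom_mult_left inner_scalar_lmonom_mult_right)
    (simp_all add: mult.commute)

context pd_functional
begin

text \<open>Abstract form shared by \<open>phi\<close> and \<open>phi_tilde\<close>:
  \<open>B\<close> is the block of lower exponents and \<open>b\<close> lists the new ones in order.
  The expansion is only modulo \<open>lspan B\<close>, which suffices for functionals vanishing
  there.\<close>

lemma orthonormal_chain:
  fixes b :: "nat \<Rightarrow> int \<times> int" and f :: "nat \<Rightarrow> laurent"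
  assumes sub: "B \<union> b ` {..<t} \<subseteq> box (Suc N) (Suc M)"
    and disj: "\<And>r. r < t \<Longrightarrow> b r \<notin> B" and inj: "inj b"
    and f: "\<And>r. r < t \<Longrightarrow> is_orthonormal_with_leading L (B \<union> b ` {..r}) (b r) (f r)"
  shows orthonormal_chain_in: "r < t \<Longrightarrow> f r \<in> lspan (B \<union> b ` {..<t})"
    and orthonormal_chain_orthogonal: "r < t \<Longrightarrow> q \<in> lspan B \<Longrightarrow> ip (f r) q = 0"
    and orthonormal_chain_expansion: "p \<in> lspan (B \<union> b ` {..<t}) \<Longrightarrow>
      p - (\<Sum>r<t. lscale (ip p (f r)) (f r)) \<in> lspan B"
proof -
  have fS: "f r \<in> lspan (B \<union> b ` {..r})" "lcoeff (f r) (b r) \<noteq> 0" "ip (f r) (f r) = 1"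
    and f0: "\<And>k. k \<in> B \<union> b ` {..r} - {b r} \<Longrightarrow> ip (f r) (lmonom k) = 0" if "r < t" for r
    using f[OF that] by (auto simp: is_orthonormal_with_leading_def)
  show f_in: "f r \<in> lspan (B \<union> b ` {..<t})" if "r < t" for r
    using fS(1)[OF that] by (rule lspan_mono) (use that in auto)
  have fV: "f r \<in> V" if "r < t" for r
    by (rule lspan_mono[OF f_in[OF that] sub])
  show orth: "ip (f r) q = 0" if "r < t" "q \<in> lspan B" for r q
  proof (rule ip_eq_zero_of_monomials)
    show "ip (f r) (lmonom k) = 0" if "k \<in> B" for k
      using that \<open>r < t\<close> disj[of r] by (intro f0) auto
  qed (use that sub fV in auto)
  have less: "ip (f r) (f s) = 0" if "s < r" "r < t" for r s
  proof (rule ip_eq_zero_of_monomials[of _ _ "B \<union> b ` {..r} - {b r}"])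
    have "b r \<notin> b ` {..s}"
      using that by (simp add: inj_image_mem_iff[OF inj])
    then have "B \<union> b ` {..s} \<subseteq> B \<union> b ` {..r} - {b r}"
      using that disj[of r] by auto
    then show "f s \<in> lspan (B \<union> b ` {..r} - {b r})"
      by (rule lspan_mono[OF fS(1), rotated]) (use that in simp)
    show "f r \<in> V" "\<And>k. k \<in> B \<union> b ` {..r} - {b r} \<Longrightarrow> ip (f r) (lmonom k) = 0"
      using that f0 fV by auto
    show "B \<union> b ` {..r} - {b r} \<subseteq> box (Suc N) (Suc M)"
      using sub that by fastforce
  qed
  have delta: "ip (f r) (f s) = (if r = s then 1 else 0)" if "r < t" "s < t" for r s
    using that less[of s r] less[of r s] fS(3) ip_commute[of "f s" "f r"] fV
    by (cases r s rule: linorder_cases) auto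
  \<comment> \<open>Existence of some coefficients: the top exponent is eliminated first, using that
    the leading coefficient of \<open>f s\<close> is nonzero.\<close>
  have ex: "\<exists>c. p - (\<Sum>r<s. lscale (c r) (f r)) \<in> lspan B"
    if "s \<le> t" "p \<in> lspan (B \<union> b ` {..<s})" for s p
    using that
  proof (induction s arbitrary: p)
    case (Suc s)
    define d where "d = lcoeff p (b s) / lcoeff (f s) (b s)"
    define p' where "p' = p - lscale d (f s)"
    have "p' \<in> lspan (B \<union> b ` {..<Suc s})"
      unfolding p'_def using Suc.prems fS(1)[of s]
      by (intro lspan_closed) (auto simp: lessThan_Suc_atMost)
    moreover have "lcoeff p' (b s) = 0"
      using fS(2)[of s] Suc.prems by (simp add: p'_def lookup_minus d_def)
    ultimately have "p' \<in> lspan (B \<union> b ` {..<s})"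
      by (auto simp: lspan_iff_keys in_keys_iff lessThan_Suc)
    then obtain c where "p' - (\<Sum>r<s. lscale (c r) (f r)) \<in> lspan B"
      using Suc by auto
    then have "p - (\<Sum>r<Suc s. lscale ((c(s := d)) r) (f r)) \<in> lspan B"
      by (simp add: p'_def algebra_simps)
    then show ?case
      by (rule exI[of _ "c(s := d)"])
  qed auto
  show "p - (\<Sum>r<t. lscale (ip p (f r)) (f r)) \<in> lspan B" if p: "p \<in> lspan (B \<union> b ` {..<t})"
  proof -
    obtain c where c: "p - (\<Sum>r<t. lscale (c r) (f r)) \<in> lspan B"
      using ex[OF _ p] by auto
    \<comment> \<open>Orthonormality, together with orthogonality to the remainder, identifies the
      coefficients.\<close>
    have "ip p (f s) = c s" if "s < t" for s
    proof -
      let ?h = "p - (\<Sum>r<t. lscale (c r) (f r))"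
      have V: "p \<in> V" "?h \<in> V" "(\<Sum>r<t. lscale (c r) (f r)) \<in> V"
        using lspan_mono[OF p sub] lspan_mono[OF c] sub fV by (auto intro!: lspan_closed(5,6))
      have "ip p (f s) = ip ?h (f s) + ip (\<Sum>r<t. lscale (c r) (f r)) (f s)"
        using V fV[OF that] by (simp add: ip_diff_left)
      also have "ip ?h (f s) = 0"
        using orth[OF that c] ip_commute[of "f s" ?h] V fV[OF that] by simp
      also have "ip (\<Sum>r<t. lscale (c r) (f r)) (f s) = (\<Sum>r<t. c r * ip (f r) (f s))"
        using fV that by (intro ip_sum_left) auto
      also have "\<dots> = (\<Sum>r<t. if r = s then c r else 0)"
        using that by (intro sum.cong) (auto simp: delta)
      finally show ?thesis using that by simp
    qed
    then show ?thesis using c by simp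
  qed
qed

section \<open>The two orthonormal families as instances of the abstract chain\<close>

lemma phi_leading_sets:
  "{(i, j). 0 \<le> i \<and> i < int n \<and> 0 \<le> j \<and> j \<le> int m} \<union> {(i, j). i = int n \<and> 0 \<le> j \<and> j \<le> int l}
     = box n (Suc m) \<union> (\<lambda>j. (int n, int j)) ` {..l}"
  "{(i, j). 0 \<le> i \<and> i \<le> int n \<and> 0 \<le> j \<and> j < int m} \<union> {(i, j). 0 \<le> i \<and> i \<le> int l \<and> j = int m}
     = box (Suc n) m \<union> (\<lambda>i. (int i, int m)) ` {..l}"
  "box n (Suc m) \<union> (\<lambda>j. (int n, int j)) ` {..<Suc m} = box (Suc n) (Suc m)"
  "box (Suc n) m \<union> (\<lambda>i. (int i, int m)) ` {..<Suc n} = box (Suc n) (Suc m)"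
proof -
  have img: "(\<lambda>j. (a, int j)) ` {..l} = {(i, j). i = a \<and> 0 \<le> j \<and> j \<le> int l}"
    "(\<lambda>i. (int i, a)) ` {..l} = {(i, j). 0 \<le> i \<and> i \<le> int l \<and> j = a}" for a :: int and l
    by (auto simp: image_iff Bex_def) (metis nat_int_comparison(3) nat_0_le)+
  show "{(i, j). 0 \<le> i \<and> i < int n \<and> 0 \<le> j \<and> j \<le> int m} \<union> {(i, j). i = int n \<and> 0 \<le> j \<and> j \<le> int l}
     = box n (Suc m) \<union> (\<lambda>j. (int n, int j)) ` {..l}"
    "{(i, j). 0 \<le> i \<and> i \<le> int n \<and> 0 \<le> j \<and> j < int m} \<union> {(i, j). 0 \<le> i \<and> i \<le> int l \<and> j = int m}
     = box (Suc n) m \<union> (\<lambda>i. (int i, int m)) ` {..l}"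
    "box n (Suc m) \<union> (\<lambda>j. (int n, int j)) ` {..<Suc m} = box (Suc n) (Suc m)"
    "box (Suc n) m \<union> (\<lambda>i. (int i, int m)) ` {..<Suc n} = box (Suc n) (Suc m)"
    unfolding img lessThan_Suc_atMost by (auto simp: box_def)
qed

context
  fixes n m :: nat
  assumes nm: "n \<le> N" "m \<le> M"
begin

lemma box_sub: "box (Suc n) (Suc m) \<subseteq> box (Suc N) (Suc M)"
  using nm by (intro box_mono) auto

lemma phi_leading:
  assumes "l < Suc m"
  shows "is_orthonormal_with_leading L (box n (Suc m) \<union> (\<lambda>j. (int n, int j)) ` {..l}) (int n, int l)
    (phi L n m l)"
  unfolding phi_def phi_leading_sets(1)
  by (rule orthonormal_with_leading_the) (use assms nm in \<open>auto simp: box_def\<close>)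

lemma phi_tilde_leading:
  assumes "l < Suc n"
  shows "is_orthonormal_with_leading L (box (Suc n) m \<union> (\<lambda>i. (int i, int m)) ` {..l}) (int l, int m)
    (phi_tilde L n m l)"
  unfolding phi_tilde_def phi_leading_sets(2)
  by (rule orthonormal_with_leading_the) (use assms nm in \<open>auto simp: box_def\<close>)

lemmas phi_chain = orthonormal_chain[where B = "box n (Suc m)" and b = "\<lambda>j. (int n, int j)"
    and t = "Suc m" and f = "phi L n m", unfolded phi_leading_sets, OF box_sub _ _ phi_leading]

lemmas phi_tilde_chain = orthonormal_chain[where B = "box (Suc n) m" and b = "\<lambda>i. (int i, int m)"
    and t = "Suc n" and f = "phi_tilde L n m", unfolded phi_leading_sets, OF box_sub _ _ phi_tilde_leading]

text \<open>Indexing by \<open>m - r\<close> matches the rows of \<open>Phi\<close>. Truncated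
  subtraction keeps the superscript at most \<open>m\<close>, so no bound on \<open>r\<close> is
  needed.\<close>

lemma phi_in: "phi L n m (m - r) \<in> lspan (box (Suc n) (Suc m))"
  and phi_orthogonal: "q \<in> lspan (box n (Suc m)) \<Longrightarrow> ip (phi L n m (m - r)) q = 0"
  and phi_expansion: "p \<in> lspan (box (Suc n) (Suc m)) \<Longrightarrow>
    p - (\<Sum>r<Suc m. lscale (ip p (phi L n m (m - r))) (phi L n m (m - r))) \<in> lspan (box n (Suc m))"
proof -
  show "phi L n m (m - r) \<in> lspan (box (Suc n) (Suc m))"
    by (rule phi_chain(1)) (auto simp: box_def inj_def)
  show "q \<in> lspan (box n (Suc m)) \<Longrightarrow> ip (phi L n m (m - r)) q = 0"
    by (rule phi_chain(2)) (auto simp: box_def inj_def)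
  show "p \<in> lspan (box (Suc n) (Suc m)) \<Longrightarrow>
    p - (\<Sum>r<Suc m. lscale (ip p (phi L n m (m - r))) (phi L n m (m - r))) \<in> lspan (box n (Suc m))"
    using phi_chain(3)[of p]
      sum.nat_diff_reindex[of "\<lambda>l. lscale (ip p (phi L n m l)) (phi L n m l)" "Suc m"]
    by (simp add: box_def inj_def del: sum.lessThan_Suc)
qed

lemma phi_tilde_in: "phi_tilde L n m (n - r) \<in> lspan (box (Suc n) (Suc m))"
  and phi_tilde_expansion: "p \<in> lspan (box (Suc n) (Suc m)) \<Longrightarrow>
    p - (\<Sum>r<Suc n. lscale (ip p (phi_tilde L n m (n - r))) (phi_tilde L n m (n - r)))
      \<in> lspan (box (Suc n) m)"
proof -
  show "phi_tilde L n m (n - r) \<in> lspan (box (Suc n) (Suc m))"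
    by (rule phi_tilde_chain(1)) (auto simp: box_def inj_def)
  show "p \<in> lspan (box (Suc n) (Suc m)) \<Longrightarrow>
    p - (\<Sum>r<Suc n. lscale (ip p (phi_tilde L n m (n - r))) (phi_tilde L n m (n - r)))
      \<in> lspan (box (Suc n) m)"
    using phi_tilde_chain(3)[of p]
      sum.nat_diff_reindex[of "\<lambda>l. lscale (ip p (phi_tilde L n m l)) (phi_tilde L n m l)" "Suc n"]
    by (simp add: box_def inj_def del: sum.lessThan_Suc)
qed

end

text \<open>The functional \<open>p \<mapsto> L (p * g)\<close> is linear and kills the remainder of
  the expansion. A general factor \<open>g\<close> also covers pairings with reversals and
  shifts.\<close>

lemma parseval:
  fixes t :: nat
  assumes rem: "p - (\<Sum>r<t. lscale (c r) (f r)) \<in> lspan B"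
    and kernel: "\<And>h. h \<in> lspan B \<Longrightarrow> L (h * g) = 0"
    and "B \<subseteq> S" and f: "\<And>r. r < t \<Longrightarrow> f r \<in> lspan S"
    and g: "\<And>x. x \<in> lspan S \<Longrightarrow> x * g \<in> Pi_space N M"
  shows "L (p * g) = (\<Sum>r<t. c r * L (f r * g))"
proof -
  have sum: "(\<Sum>r<s. lscale (c r) (f r)) \<in> lspan S \<and>
      L ((\<Sum>r<s. lscale (c r) (f r)) * g) = (\<Sum>r<s. c r * L (f r * g))" if "s \<le> t" for s
    using that
  proof (induction s)
    case 0
    have "(0 :: laurent) \<in> Pi_space N M"
      by (simp add: Pi_space_def lspan_closed)
    then show ?case
      using L_scale[of 0 0] by (simp add: lspan_closed lscale_def)
  next
    case (Suc s)
    have fs: "lscale (c s) (f s) \<in> lspan S"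
      using f[of s] Suc.prems by (intro lspan_closed) auto
    have "L (lscale (c s) (f s) * g) = c s * L (f s * g)"
      using f[of s] g Suc.prems by (simp add: lscale_mult(1) L_scale)
    with Suc fs g show ?case
      by (simp add: lspan_closed(3) distrib_right L_add)
  qed
  let ?h = "p - (\<Sum>r<t. lscale (c r) (f r))"
  have "?h \<in> lspan S"
    using rem \<open>B \<subseteq> S\<close> by (rule lspan_mono)
  then have "L (?h * g + (\<Sum>r<t. lscale (c r) (f r)) * g)
      = L (?h * g) + L ((\<Sum>r<t. lscale (c r) (f r)) * g)"
    using g sum[of t] by (intro L_add) auto
  then show ?thesis
    using kernel[OF rem] sum[of t] by (simp flip: distrib_right)
qed

end

subsection \<open>Recurrences\<close>

text \<open>Reversal exchanges the lower space \<open>lspan (box n (Suc m))\<close> with its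
  multiple by z. The reversed \<open>h\<close> is therefore orthogonal to the lower space, so its
  expansion in \<open>phi\<close> is exact and can be reversed back.\<close>

lemma (in pd_functional) reverse_expansion:
  assumes nm: "n \<le> N" "m \<le> M" and h: "h \<in> lspan (box (Suc n) (Suc m))"
    and orth: "\<And>q. q \<in> lspan (box n (Suc m)) \<Longrightarrow> ip h (lmonom (1, 0) * q) = 0"
  shows "h = (\<Sum>r<Suc m. lscale (ip h (reverse_poly n m (phi L n m (m - r))))
    (reverse_poly n m (phi L n m (m - r))))"
proof -
  let ?f = "\<lambda>r. phi L n m (m - r)"
  define g where "g = reverse_poly n m h"
  define d where "d = g - (\<Sum>r<Suc m. lscale (ip g (?f r)) (?f r))"
  have toV: "p \<in> V" if "p \<in> lspan (box (Suc n) (Suc m))" for p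
    using that box_sub[OF nm] by (rule lspan_mono)
  have g: "g \<in> lspan (box (Suc n) (Suc m))"
    unfolding g_def using h by (rule reverse_poly_box)
  have d: "d \<in> lspan (box n (Suc m))"
    unfolding d_def by (rule phi_expansion[OF nm g])
  have d': "d \<in> lspan (box (Suc n) (Suc m))"
    using d by (rule lspan_mono) (auto simp: box_def)
  have "ip g d = ip (reverse_poly n m d) h"
    unfolding g_def by (rule inner_scalar_reverse_poly_swap(2))
  also have "\<dots> = cnj (ip h (reverse_poly n m d))"
    by (rule ip_commute) (use h d' in \<open>auto intro: toV reverse_poly_box\<close>)
  \<comment> \<open>The exponents of z in the reversal of \<open>d\<close> are at least 1; splitting
    off a factor z makes \<open>orth\<close> applicable.\<close>
  also have "reverse_poly n m d = lmonom (1, 0) * (lmonom (-1, 0) * reverse_poly n m d)"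
    by (simp add: lmonom_mult zero_prod_def flip: mult.assoc) (simp flip: zero_prod_def)
  also have "ip h \<dots> = 0"
    by (rule orth, rule lspan_lmonom_mult[OF lspan_reverse_poly[OF d,
      where U = "{1..int n} \<times> {0..int m}"]]) (auto simp: box_def)
  finally have "ip g d = 0" by simp
  moreover have "ip (?f r) d = 0" for r
    using phi_orthogonal[OF nm d] .
  moreover have "ip (\<Sum>r<Suc m. lscale (ip g (?f r)) (?f r)) d = (\<Sum>r<Suc m. ip g (?f r) * ip (?f r) d)"
    by (rule ip_sum_left) (use phi_in[OF nm] d' toV in auto)
  moreover have "ip d d = ip g d - ip (\<Sum>r<Suc m. lscale (ip g (?f r)) (?f r)) d"
    by (subst (1) d_def, rule ip_diff_left)
      (use g d' phi_in[OF nm] in \<open>auto intro!: toV lspan_closed(5,6) simp del: sum.lessThan_Suc\<close>)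
  ultimately have "ip d d = 0" by simp
  then have "d = 0"
    using ip_pos[OF toV[OF d']] by auto
  then have "h = reverse_poly n m (\<Sum>r<Suc m. lscale (ip g (?f r)) (?f r))"
    by (simp add: d_def g_def del: sum.lessThan_Suc)
  also have "\<dots> = (\<Sum>r<Suc m. lscale (cnj (ip g (?f r))) (reverse_poly n m (?f r)))"
    by (simp add: reverse_poly_def ldagger_sum ldagger_lscale sum_distrib_left lscale_mult
        del: sum.lessThan_Suc)
  also have "\<dots> = (\<Sum>r<Suc m. lscale (ip h (reverse_poly n m (?f r))) (reverse_poly n m (?f r)))"
  proof (intro sum.cong refl)
    fix r
    have "ip g (?f r) = ip (reverse_poly n m (?f r)) h"
      unfolding g_def by (rule inner_scalar_reverse_poly_swap(2))
    also have "\<dots> = cnj (ip h (reverse_poly n m (?f r)))"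
      by (rule ip_commute) (use h phi_in[OF nm] in \<open>auto intro: toV reverse_poly_box\<close>)
    finally show "lscale (cnj (ip g (?f r))) (reverse_poly n m (?f r)) =
        lscale (ip h (reverse_poly n m (?f r))) (reverse_poly n m (?f r))"
      by simp
  qed
  finally show ?thesis .
qed

text \<open>
  Here k and m stand for \<open>n - 1\<close> and \<open>m - 1\<close> in \<open>lemma3p13\<close>. The argument of F, G, F', T is
  the row index in the corresponding column vector, which runs against the superscript.
\<close>

locale adjacent_levels = pd_functional +
  fixes k m :: nat
  assumes k: "Suc k \<le> N" and m: "Suc m \<le> M"
begin

abbreviation "F r \<equiv> phi L k m (m - r)"
abbreviation "G r \<equiv> phi L k (Suc m) (Suc m - r)"
abbreviation "F' r \<equiv> phi L (Suc k) m (m - r)"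
abbreviation "T r \<equiv> phi_tilde L k (Suc m) (k - r)"

lemma V_of_box:
  assumes "p \<in> lspan (box a b)" "a \<le> Suc (Suc k)" "b \<le> Suc (Suc m)"
  shows "p \<in> V"
  using assms(1) by (rule lspan_mono) (use assms k m in \<open>intro box_mono, auto\<close>)

lemma F_in: "F r \<in> lspan (box (Suc k) (Suc m))"
  and G_in: "G r \<in> lspan (box (Suc k) (Suc (Suc m)))"
  and F'_in: "F' r \<in> lspan (box (Suc (Suc k)) (Suc m))"
  and T_in: "T r \<in> lspan (box (Suc k) (Suc (Suc m)))"
  using k m by (auto intro!: phi_in phi_tilde_in simp del: diff_Suc_Suc)

lemma shift_box:
  "p \<in> lspan (box a b) \<Longrightarrow> lmonom (1, 0) * p \<in> lspan (box (Suc a) b)"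
  "p \<in> lspan (box a b) \<Longrightarrow> lmonom (0, 1) * p \<in> lspan (box a (Suc b))"
  by (auto intro!: lspan_lmonom_mult simp: box_def)

lemmas in_box = F_in G_in F'_in T_in shift_box reverse_poly_box

lemma in_V: "F r \<in> V" "G r \<in> V" "F' r \<in> V" "T r \<in> V"
  "lmonom (1, 0) * F r \<in> V" "lmonom (0, 1) * F r \<in> V" "lmonom (0, 1) * F' r \<in> V"
  "reverse_poly k (Suc m) (G r) \<in> V"
  by (simp_all add: V_of_box[OF F_in] V_of_box[OF G_in] V_of_box[OF F'_in] V_of_box[OF T_in]
    V_of_box[OF shift_box(1)[OF F_in]] V_of_box[OF shift_box(2)[OF F_in]]
    V_of_box[OF shift_box(2)[OF F'_in]] V_of_box[OF reverse_poly_box[OF G_in]])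

lemma z_recurrence:
  "lmonom (1, 0) * F a =
     (\<Sum>r<Suc m. lscale (ip (lmonom (1, 0) * F a) (F' r)) (F' r)) +
     (\<Sum>r<Suc m. lscale (ip (lmonom (1, 0) * F a) (reverse_poly k m (F r))) (reverse_poly k m (F r)))"
proof -
  let ?z = "lmonom (1, 0)"
  let ?s = "\<Sum>r<Suc m. lscale (ip (?z * F a) (F' r)) (F' r)"
  define h where "h = ?z * F a - ?s"
  have nm: "Suc k \<le> N" "m \<le> M" "k \<le> N" using k m by auto
  have h: "h \<in> lspan (box (Suc k) (Suc m))"
    unfolding h_def by (rule phi_expansion[OF nm(1,2)]) (intro in_box)
  have s: "?s \<in> V" "?z * F a \<in> V"
    using in_V by (auto intro!: lspan_closed(5,6) simp del: sum.lessThan_Suc)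
  \<comment> \<open>The subtracted part is orthogonal to this space. The fact serves twice: for the
    orthogonality required by \<open>reverse_expansion\<close>, and to replace \<open>h\<close> in
    the resulting coefficients.\<close>
  have ip_h: "ip h q = ip (?z * F a) q"
    if "q \<in> lspan (box (Suc k) (Suc m))" for q
  proof -
    have qV: "q \<in> V" using that by (rule V_of_box) auto
    have "ip ?s q = (\<Sum>r<Suc m. ip (?z * F a) (F' r) * ip (F' r) q)"
      by (rule ip_sum_left) (use in_V qV in auto)
    then have "ip ?s q = 0"
      using phi_orthogonal[OF nm(1,2) that] by simp
    then show ?thesis
      unfolding h_def using s qV by (simp add: ip_diff_left del: sum.lessThan_Suc)
  qed
  have "h = (\<Sum>r<Suc m. lscale (ip h (reverse_poly k m (F r))) (reverse_poly k m (F r)))"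
  proof (rule reverse_expansion[OF nm(3,2) h])
    fix q assume q: "q \<in> lspan (box k (Suc m))"
    then have "ip h (?z * q) = ip (?z * F a) (?z * q)"
      by (intro ip_h shift_box)
    also have "\<dots> = ip (F a) q"
      by (simp only: inner_scalar_lmonom_mult) (simp add: inner_scalar_def)
    also have "\<dots> = 0"
      by (rule phi_orthogonal[OF nm(3,2) q])
    finally show "ip h (?z * q) = 0" .
  qed
  also have "\<dots> = (\<Sum>r<Suc m. lscale (ip (?z * F a) (reverse_poly k m (F r))) (reverse_poly k m (F r)))"
    using ip_h in_box by (intro sum.cong) auto
  finally show ?thesis
    unfolding h_def by (simp add: algebra_simps del: sum.lessThan_Suc)
qed

text \<open>The multiplier \<open>e\<close> is 1 in the first relation and w in the second.\<close>

lemma ip_z_recurrence: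
  assumes "y \<in> V" and e: "\<And>x. x \<in> lspan (box (Suc (Suc k)) (Suc m)) \<Longrightarrow> e * x \<in> V"
  shows "ip (e * (lmonom (1, 0) * F a)) y =
     (\<Sum>r<Suc m. ip (lmonom (1, 0) * F a) (F' r) * ip (e * F' r) y) +
     (\<Sum>r<Suc m. ip (lmonom (1, 0) * F a) (reverse_poly k m (F r)) * ip (e * reverse_poly k m (F r)) y)"
proof -
  have eV: "e * F' r \<in> V" "e * reverse_poly k m (F r) \<in> V" for r
    by (rule e[OF F'_in], rule e, rule lspan_mono[OF reverse_poly_box[OF F_in]]) (auto simp: box_def)
  show ?thesis
    by (subst (1) z_recurrence)
      (simp add: distrib_left sum_distrib_left lscale_mult ip_add_left ip_sum_left eV assms(1)
        lspan_closed(5,6) del: sum.lessThan_Suc)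
qed

text \<open>For \<open>h\<close> in \<open>lspan (box k (Suc (Suc m)))\<close> the reversal of z h
  has exponents of z from 0 to \<open>k - 1\<close>, so it is orthogonal to \<open>G b\<close>;
  swapping reversals shows that the functional vanishes on \<open>h\<close>. The relations take
  \<open>p\<close> to be \<open>F a\<close> and w times \<open>F c\<close>.\<close>

lemma Gamma_E_hat_sum:
  assumes p: "p \<in> lspan (box (Suc k) (Suc (Suc m)))"
  shows "(\<Sum>r<Suc (Suc m). ip p (G r) * ip (lmonom (1, 0) * G r) (reverse_poly k (Suc m) (G b)))
    = ip (lmonom (1, 0) * p) (reverse_poly k (Suc m) (G b))"
proof -
  let ?z = "lmonom (1, 0)" and ?y = "reverse_poly k (Suc m) (G b)"
  have nm: "k \<le> N" "Suc m \<le> M" using k m by auto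
  have y: "?y \<in> V"
    by (intro in_V)+
  have eq: "ip (?z * x) ?y = L (x * (?z * ldagger ?y))" for x
    by (simp add: inner_scalar_def mult_ac)
  show ?thesis
    unfolding eq
  proof (rule sym, rule parseval[where B = "box k (Suc (Suc m))" and S = "box (Suc k) (Suc (Suc m))"])
    show "p - (\<Sum>r<Suc (Suc m). lscale (ip p (G r)) (G r)) \<in> lspan (box k (Suc (Suc m)))"
      by (rule phi_expansion[OF nm p])
    fix h assume h: "h \<in> lspan (box k (Suc (Suc m)))"
    have "ip (?z * h) ?y = ip (G b) (reverse_poly k (Suc m) (?z * h))"
      by (rule inner_scalar_reverse_poly_swap(1))
    also have "\<dots> = 0"
      by (rule phi_orthogonal[OF nm], rule lspan_reverse_poly[OF lspan_lmonom_mult[OF h,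
            where U = "{1..int k} \<times> {0..int (Suc m)}"]])
        (auto simp: box_def)
    finally show "L (h * (?z * ldagger ?y)) = 0"
      by (simp only: eq)
  next
    fix x assume "x \<in> lspan (box (Suc k) (Suc (Suc m)))"
    then have "?z * x * ldagger ?y \<in> Pi_space N M"
      using y by (intro mult_ldagger_in_Pi_space V_of_box[OF shift_box(1)]) auto
    then show "x * (?z * ldagger ?y) \<in> Pi_space N M"
      by (simp add: mult_ac)
  qed (use G_in in \<open>auto simp: box_def\<close>)
qed

text \<open>\<open>F' r\<close> is orthogonal to \<open>lspan (box (Suc k) (Suc m))\<close>, so only
  the components of the reversed \<open>G b\<close> along the \<open>T s\<close> contribute.\<close>

lemma K_I1_sum:
  "ip (F' r) (reverse_poly k (Suc m) (G b)) =
     (\<Sum>s<Suc k. ip (F' r) (T s) * cnj (ip (reverse_poly k (Suc m) (G b)) (T s)))"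
proof -
  let ?y = "reverse_poly k (Suc m) (G b)"
  have nm: "k \<le> N" "Suc m \<le> M" "Suc k \<le> N" "m \<le> M" using k m by auto
  have y: "?y \<in> lspan (box (Suc k) (Suc (Suc m)))"
    by (intro in_box)
  have V: "?y \<in> V" "F' r \<in> V" "T s \<in> V" for s
    by (intro in_V)+
  have "L (?y * ldagger (F' r)) = (\<Sum>s<Suc k. ip ?y (T s) * L (T s * ldagger (F' r)))"
  proof (rule parseval[where B = "box (Suc k) (Suc m)" and S = "box (Suc k) (Suc (Suc m))"])
    show "?y - (\<Sum>s<Suc k. lscale (ip ?y (T s)) (T s)) \<in> lspan (box (Suc k) (Suc m))"
      by (rule phi_tilde_expansion[OF nm(1,2) y])
    fix h assume h: "h \<in> lspan (box (Suc k) (Suc m))"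
    then have "ip (F' r) h = 0"
      by (rule phi_orthogonal[OF nm(3,4)])
    then show "L (h * ldagger (F' r)) = 0"
      using ip_commute[of "F' r" h] V V_of_box[OF h] by (simp add: inner_scalar_def)
  next
    fix x assume "x \<in> lspan (box (Suc k) (Suc (Suc m)))"
    then have "x \<in> V"
      by (rule V_of_box) auto
    then show "x * ldagger (F' r) \<in> Pi_space N M"
      using V by (intro mult_ldagger_in_Pi_space)
  qed (use T_in in \<open>auto simp: box_def\<close>)
  then have "ip ?y (F' r) = (\<Sum>s<Suc k. ip ?y (T s) * ip (T s) (F' r))"
    by (simp only: inner_scalar_def)
  \<comment> \<open>\<open>parseval\<close> expands the first argument, so the wanted identity
    appears conjugated.\<close>
  then have "cnj (ip ?y (F' r)) = (\<Sum>s<Suc k. cnj (ip (T s) (F' r)) * cnj (ip ?y (T s)))"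
    by (simp add: mult.commute del: sum.lessThan_Suc)
  then show ?thesis
    using V by (simp only: ip_commute[symmetric])
qed

text \<open>For \<open>h\<close> in \<open>lspan (box (Suc k) (Suc m))\<close>, the reversal to
  degree \<open>Suc m\<close> in w is w times the reversal to degree \<open>m\<close>. The factors w
  cancel, leaving \<open>F' r\<close> paired with a space orthogonal to it.\<close>

lemma I_K1_sum:
  "ip (lmonom (0, 1) * F' r) (reverse_poly k (Suc m) (G a)) =
     (\<Sum>s<Suc k. ip (G a) (T s) * ip (lmonom (0, 1) * F' r) (reverse_poly k (Suc m) (T s)))"
proof -
  let ?w = "lmonom (0, 1)"
  \<comment> \<open>Reversal and the second slot of \<open>ip\<close> both conjugate, so the pairing
    is linear in the reversed polynomial; \<open>e\<close> is its multiplier.\<close>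
  define e where "e = ?w * F' r * lmonom (- int k, - int (Suc m))"
  have nm: "k \<le> N" "Suc m \<le> M" "Suc k \<le> N" "m \<le> M" using k m by auto
  have V: "?w * F' r \<in> V" "F' r \<in> V" "T s \<in> V" for s
    by (intro in_V)+
  have eq: "ip (?w * F' r) (reverse_poly k (Suc m) x) = L (x * e)" for x
    by (simp add: inner_scalar_def reverse_poly_def ldagger_mult ldagger_lmonom e_def mult_ac)
  show ?thesis
    unfolding eq
  proof (rule parseval[where B = "box (Suc k) (Suc m)" and S = "box (Suc k) (Suc (Suc m))"])
    show "G a - (\<Sum>s<Suc k. lscale (ip (G a) (T s)) (T s)) \<in> lspan (box (Suc k) (Suc m))"
      by (rule phi_tilde_expansion[OF nm(1,2) G_in])
    fix h assume h: "h \<in> lspan (box (Suc k) (Suc m))"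
    have "ip (?w * F' r) (reverse_poly k (Suc m) h) = ip (F' r) (reverse_poly k m h)"
      by (simp only: reverse_poly_def inner_scalar_lmonom_mult)
        (simp add: inner_scalar_lmonom_mult_right)
    also have "\<dots> = 0"
      by (rule phi_orthogonal[OF nm(3,4)]) (rule reverse_poly_box[OF h])
    finally show "L (h * e) = 0"
      by (simp only: eq)
  next
    fix x assume x: "x \<in> lspan (box (Suc k) (Suc (Suc m)))"
    have "?w * F' r * ldagger (reverse_poly k (Suc m) x) \<in> Pi_space N M"
      using V reverse_poly_box[OF x] by (intro mult_ldagger_in_Pi_space) (auto intro!: V_of_box)
    then show "x * e \<in> Pi_space N M"
      by (simp add: e_def reverse_poly_def ldagger_mult ldagger_lmonom mult_ac)
  qed (use T_in in \<open>auto simp: box_def\<close>)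
qed

section \<open>The two relations, entry by entry\<close>

lemma first_relation:
  "(\<Sum>r<Suc (Suc m). ip (F a) (G r) * ip (lmonom (1, 0) * G r) (reverse_poly k (Suc m) (G b))) =
   (\<Sum>s<Suc k. (\<Sum>r<Suc m. ip (lmonom (1, 0) * F a) (F' r) * ip (F' r) (T s)) *
      cnj (ip (reverse_poly k (Suc m) (G b)) (T s))) +
   (\<Sum>r<Suc m. ip (lmonom (1, 0) * F a) (reverse_poly k m (F r)) * cnj (ip (lmonom (0, 1) * F r) (G b)))"
proof -
  let ?z = "lmonom (1, 0)" and ?y = "reverse_poly k (Suc m) (G b)"
  have V: "?y \<in> V" "lmonom (0, 1) * F r \<in> V" "G b \<in> V" for r
    by (intro in_V)+
  \<comment> \<open>The monomials in the two reversals differ by a factor w, which moves onto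
    \<open>F r\<close>.\<close>
  have "ip (reverse_poly k m (F r)) ?y = cnj (ip (lmonom (0, 1) * F r) (G b))" for r
  proof -
    have "ip (reverse_poly k m (F r)) ?y = ip (G b) (lmonom (0, 1) * F r)"
      by (simp only: reverse_poly_def inner_scalar_lmonom_mult)
        (simp only: inner_scalar_lmonom_mult_right, simp add: mult.commute)
    then show ?thesis
      using ip_commute[of "lmonom (0, 1) * F r" "G b"] V by simp
  qed
  moreover have "F a \<in> lspan (box (Suc k) (Suc (Suc m)))"
    using F_in by (rule lspan_mono) (auto simp: box_def)
  moreover have "ip (1 * (?z * F a)) ?y =
     (\<Sum>r<Suc m. ip (?z * F a) (F' r) * ip (1 * F' r) ?y) +
     (\<Sum>r<Suc m. ip (?z * F a) (reverse_poly k m (F r)) * ip (1 * reverse_poly k m (F r)) ?y)"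
    by (rule ip_z_recurrence[OF V(1)]) (auto intro: V_of_box)
  moreover have "(\<Sum>r<Suc m. ip (?z * F a) (F' r) * ip (F' r) ?y) =
    (\<Sum>s<Suc k. (\<Sum>r<Suc m. ip (?z * F a) (F' r) * ip (F' r) (T s)) * cnj (ip ?y (T s)))"
    unfolding K_I1_sum sum_distrib_left sum_distrib_right
    by (subst sum.swap) (simp only: mult.assoc)
  ultimately show ?thesis
    by (simp add: Gamma_E_hat_sum del: sum.lessThan_Suc)
qed

lemma second_relation:
  "(\<Sum>r<Suc (Suc m). ip (lmonom (1, 0) * G a) (reverse_poly k (Suc m) (G r)) * ip (lmonom (0, 1) * F c) (G r)) =
   (\<Sum>r<Suc m. (\<Sum>s<Suc k. ip (G a) (T s) * ip (lmonom (0, 1) * F' r) (reverse_poly k (Suc m) (T s))) *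
      ip (lmonom (1, 0) * F c) (F' r)) +
   (\<Sum>r<Suc m. cnj (ip (F r) (G a)) * ip (lmonom (1, 0) * F r) (reverse_poly k m (F c)))"
proof -
  let ?z = "lmonom (1, 0)" and ?w = "lmonom (0, 1)" and ?y = "reverse_poly k (Suc m) (G a)"
  have V: "?y \<in> V" "F r \<in> V" "G a \<in> V" for r
    by (intro in_V)+
  \<comment> \<open>This is the symmetry of \<open>E_hat\<close>, used at both levels to transpose
    its entries.\<close>
  have sym: "ip (?z * p) (reverse_poly i j q) = ip (?z * q) (reverse_poly i j p)" for p q i j
    by (simp only: reverse_poly_def inner_scalar_lmonom_mult) (simp add: mult.commute)
  have "ip (?w * reverse_poly k m (F r)) ?y = cnj (ip (F r) (G a))" for r
  proof -
    have "?w * reverse_poly k m (F r) = reverse_poly k (Suc m) (F r)"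
      by (simp add: reverse_poly_def lmonom_mult flip: mult.assoc)
    then have "ip (?w * reverse_poly k m (F r)) ?y = ip (G a) (F r)"
      by (simp add: inner_scalar_reverse_poly_swap(2)[where p = "F r"])
    then show ?thesis
      using ip_commute[of "F r" "G a"] V by simp
  qed
  moreover have "(\<Sum>r<Suc (Suc m). ip (?w * F c) (G r) * ip (?z * G r) ?y) = ip (?z * (?w * F c)) ?y"
    by (rule Gamma_E_hat_sum) (intro in_box)
  moreover have "?z * (?w * F c) = ?w * (?z * F c)"
    by (simp add: mult_ac)
  moreover have "ip (?w * (?z * F c)) ?y =
     (\<Sum>r<Suc m. ip (?z * F c) (F' r) * ip (?w * F' r) ?y) +
     (\<Sum>r<Suc m. ip (?z * F c) (reverse_poly k m (F r)) * ip (?w * reverse_poly k m (F r)) ?y)"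
    by (rule ip_z_recurrence[OF V(1)]) (auto intro: V_of_box shift_box)
  ultimately show ?thesis
    unfolding I_K1_sum sym[of "G a"] sym[of "F c"] by (simp only: mult.commute)
qed

end

subsection \<open>Matrix form\<close>

lemma mat_adjoint_index [simp]:
  "dim_row (mat_adjoint A) = dim_col A" "dim_col (mat_adjoint A) = dim_row A"
  "i < dim_col A \<Longrightarrow> j < dim_row A \<Longrightarrow> mat_adjoint A $$ (i, j) = conjugate (A $$ (j, i))"
  by (simp_all add: mat_adjoint_def mat_of_rows_def)

text \<open>With a single column, each entry of the matrix product is one product of polynomials, so
  \<open>L\<close> is applied without any use of additivity.\<close>

lemma inner_mat_columns:
  assumes "dim_col X = 1" "dim_col Y = 1"
  shows "inner_mat L X Y = mat (dim_row X) (dim_row Y) (\<lambda>(i, j). inner_scalar L (X $$ (i, 0)) (Y $$ (j, 0)))"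
  using assms by (intro eq_matI)
    (auto simp: inner_mat_def mat_ldagger_def inner_scalar_def scalar_prod_def)

lemma transpose_reversal:
  "transpose_mat (reversal n m X) =
     mat (dim_row X) (dim_col X) (\<lambda>(i, j). reverse_poly n m (X $$ (i, j)))"
  by (rule eq_matI) (auto simp: reversal_def mat_ldagger_def reverse_poly_def)

theorem lemma3p13:
  fixes L :: "laurent \<Rightarrow> complex" and N M n m :: nat
  assumes "positive_definite_functional N M L"
    and "0 < n" and "n \<le> N" and "0 < m" and "m \<le> M"
  shows "Gamma_mat L (n - 1) m * E_hat L n m =
           A_mat L n (m - 1) * K_mat L n m * mat_adjoint (I1_mat L (n - 1) m)
           + E_hat L n (m - 1) * map_mat cnj (Gamma1_mat L (n - 1) m)
       \<and> E_hat L n m * transpose_mat (Gamma1_mat L (n - 1) m) =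
           I_mat L (n - 1) m * transpose_mat (K1_mat L n m) * transpose_mat (A_mat L n (m - 1))
           + mat_adjoint (Gamma_mat L (n - 1) m) * E_hat L n (m - 1)"
proof -
  obtain k m' where km: "n = Suc k" "m = Suc m'"
    using assms by (metis gr0_implies_Suc)
  interpret adjacent_levels L N M k m'
    by unfold_locales (use assms km in auto)
  note mats = Gamma_mat_def E_hat_def A_mat_def K_mat_def I1_mat_def Gamma1_mat_def I_mat_def
    K1_mat_def inner_mat_columns transpose_reversal Phi_def Phi_tilde_def scalar_prod_def
    atLeast0LessThan
  show ?thesis
    unfolding km
  \<comment> \<open>Each matrix equation yields one goal for entries and two for dimensions; goals 1
    and 4 are those for entries.\<close>
  proof (intro conjI eq_matI, goal_cases)
    case (1 a b)
    then show ?case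
      using first_relation[of a b] by (simp add: mats del: sum.lessThan_Suc)
  next
    case (4 a c)
    then show ?case
      using second_relation[of a c] by (simp add: mats del: sum.lessThan_Suc)
  qed (simp_all add: mats del: sum.lessThan_Suc)
qed

end
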